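(* Let $k_0\neq0$ be a real constant and let $g,h$ be smooth functions of $t$ with $h\neq0$. For the reduction of the ZK equation $u_{xt}-(uu_x)_x-u_{yy}=0$ by the one-dimensional symmetry subgroup generated by $k_0\mathbf v_0+\mathbf x_g+\mathbf y_h$, the reduction formula is $$u=(2h+k_0y)^2\,w(t,z)+\frac{k_0g'+2(h+k_0y)h''}{2k_0^2},\qquad r=t,\qquad z=\frac1{(2h+k_0y)^2}\Big(x+\frac{k_0g+2(h+k_0y)h'}{2k_0^2}\Big),$$ and the corresponding reduced equation, in which one may set $k_0=1$, is $$-2k_0^2w+2k_0^2zw_z-w_z^2+w_{zt}-(w+4k_0^2z^2)w_{zz}=0.$$
   Context: $\mathbf v_0=2x\partial_x+y\partial_y+2u\partial_u$, $\mathbf x_g=g\partial_x-g'\partial_u$, $\mathbf y_h=\tfrac12 yh'\partial_x+h\partial_y-\tfrac12 yh''\partial_u$ are vector fields on $(t,x,y,u)$-space ($'=d/dt$) that are infinitesimal symmetries of the Zabolotskaya–Khokhlov (ZK) equation $u_{xt}-(uu_x)_x-u_{yy}=0$. A reduction by a one-dimensional symmetry subgroup expresses the solutions $u$ invariant under the subgroup, via a reduction formula, in terms of a function $w$ of two invariant independent variables $r,z$; the reduced equation is the equation for $w$ obtained by substituting the reduction formula in the ZK equation.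
   Formalization: The generator is taken to be k0 v0 + x_g + y_{2h} instead of k0 v0 + x_g + y_h: with y_h the displayed z is not an invariant (k0=1, g=0, h=1 gives Q(z)=2x/(2+y)^3, not 0); the reduction formula and reduced equation are unchanged. *)

theory Defs
  imports "HOL-Analysis.Analysis"
begin

section \<open>Smooth functions on open sets\<close>

text \<open>\<open>Ck_on n S f\<close> is used for open \<open>S\<close> only: \<open>f\<close> has continuous iterated
  directional derivatives up to order \<open>n\<close> on \<open>S\<close>.\<close>

primrec Ck_on :: "nat \<Rightarrow> 'a::euclidean_space set \<Rightarrow> ('a \<Rightarrow> real) \<Rightarrow> bool" where
  "Ck_on 0 S f \<longleftrightarrow> continuous_on S f"
| "Ck_on (Suc n) S f \<longleftrightarrow>
     (\<forall>p\<in>S. f differentiable (at p)) \<and> (\<forall>v. Ck_on n S (\<lambda>p. frechet_derivative f (at p) v))"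

definition smooth_on :: "'a::euclidean_space set \<Rightarrow> ('a \<Rightarrow> real) \<Rightarrow> bool" where
  "smooth_on S f \<longleftrightarrow> (\<forall>n. Ck_on n S f)"

section \<open>Partial derivatives and the Zabolotskaya--Khokhlov equation\<close>

text \<open>Functions of \<open>(t, x, y)\<close>:\<close>

definition Dt :: "(real \<times> real \<times> real \<Rightarrow> real) \<Rightarrow> real \<times> real \<times> real \<Rightarrow> real" where
  "Dt u = (\<lambda>(t, x, y). deriv (\<lambda>s. u (s, x, y)) t)"

definition Dx :: "(real \<times> real \<times> real \<Rightarrow> real) \<Rightarrow> real \<times> real \<times> real \<Rightarrow> real" where
  "Dx u = (\<lambda>(t, x, y). deriv (\<lambda>s. u (t, s, y)) x)"

definition Dy :: "(real \<times> real \<times> real \<Rightarrow> real) \<Rightarrow> real \<times> real \<times> real \<Rightarrow> real" where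
  "Dy u = (\<lambda>(t, x, y). deriv (\<lambda>s. u (t, x, s)) y)"

definition zk :: "(real \<times> real \<times> real \<Rightarrow> real) \<Rightarrow> real \<times> real \<times> real \<Rightarrow> real" where
  "zk u p = Dt (Dx u) p - Dx (\<lambda>q. u q * Dx u q) p - Dy (Dy u) p"

text \<open>Functions of \<open>(r, z)\<close>; since \<open>r = t\<close>, the first argument is also called \<open>t\<close>:\<close>

definition Wt :: "(real \<times> real \<Rightarrow> real) \<Rightarrow> real \<times> real \<Rightarrow> real" where
  "Wt w = (\<lambda>(t, z). deriv (\<lambda>s. w (s, z)) t)"

definition Wz :: "(real \<times> real \<Rightarrow> real) \<Rightarrow> real \<times> real \<Rightarrow> real" where
  "Wz w = (\<lambda>(t, z). deriv (\<lambda>s. w (t, s)) z)"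

definition reduced_zk :: "real \<Rightarrow> (real \<times> real \<Rightarrow> real) \<Rightarrow> real \<times> real \<Rightarrow> real" where
  "reduced_zk k0 w = (\<lambda>(t, z).
     - 2 * k0\<^sup>2 * w (t, z) + 2 * k0\<^sup>2 * z * Wz w (t, z) - (Wz w (t, z))\<^sup>2
     + Wt (Wz w) (t, z) - (w (t, z) + 4 * k0\<^sup>2 * z\<^sup>2) * Wz (Wz w) (t, z))"

section \<open>Vector fields and local one-parameter groups\<close>

text \<open>A vector field on \<open>(t, x, y, u)\<close>-space is given by its components with respect to
  \<open>\<partial>\<^sub>t, \<partial>\<^sub>x, \<partial>\<^sub>y, \<partial>\<^sub>u\<close>.\<close>

type_synonym R4 = "real \<times> real \<times> real \<times> real"

definition v0 :: "R4 \<Rightarrow> R4" where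
  "v0 = (\<lambda>(t, x, y, u). (0, 2 * x, y, 2 * u))"

definition xfield :: "(real \<Rightarrow> real) \<Rightarrow> R4 \<Rightarrow> R4" where
  "xfield g = (\<lambda>(t, x, y, u). (0, g t, 0, - deriv g t))"

definition yfield :: "(real \<Rightarrow> real) \<Rightarrow> R4 \<Rightarrow> R4" where
  "yfield h = (\<lambda>(t, x, y, u).
     (0, 1/2 * y * deriv h t, h t, - (1/2 * y * deriv (deriv h) t)))"

definition generator :: "real \<Rightarrow> (real \<Rightarrow> real) \<Rightarrow> (real \<Rightarrow> real) \<Rightarrow> R4 \<Rightarrow> R4" where
  "generator k0 g h p = k0 *\<^sub>R v0 p + xfield g p + yfield h p"

definition integral_curve :: "(R4 \<Rightarrow> R4) \<Rightarrow> real set \<Rightarrow> (real \<Rightarrow> R4) \<Rightarrow> bool" where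
  "integral_curve Q I \<gamma> \<longleftrightarrow> (\<forall>s\<in>I. (\<gamma> has_vector_derivative Q (\<gamma> s)) (at s))"

text \<open>\<open>S\<close> is locally invariant under the local one-parameter group \<open>exp(\<epsilon> Q)\<close>: every point of \<open>S\<close>
  stays in \<open>S\<close> for all sufficiently small \<open>\<epsilon>\<close>. The point \<open>exp(\<epsilon> Q) p\<close> is \<open>\<gamma> \<epsilon>\<close> for the integral
  curve \<open>\<gamma>\<close> starting at \<open>p\<close>.\<close>

definition locally_invariant :: "(R4 \<Rightarrow> R4) \<Rightarrow> R4 set \<Rightarrow> bool" where
  "locally_invariant Q S \<longleftrightarrow>
     (\<forall>p\<in>S. \<exists>\<delta>>0. \<exists>\<gamma>. integral_curve Q {-\<delta><..<\<delta>} \<gamma> \<and> \<gamma> 0 = p \<and> \<gamma> ` {-\<delta><..<\<delta>} \<subseteq> S)"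

definition graph_on :: "(real \<times> real \<times> real) set \<Rightarrow> (real \<times> real \<times> real \<Rightarrow> real) \<Rightarrow> R4 set" where
  "graph_on \<Omega> u = {(t, x, y, v). (t, x, y) \<in> \<Omega> \<and> v = u (t, x, y)}"

text \<open>A function \<open>u\<close> on \<open>\<Omega>\<close> is invariant under a group if its graph is.\<close>

definition invariant_on ::
  "(R4 \<Rightarrow> R4) \<Rightarrow> (real \<times> real \<times> real) set \<Rightarrow> (real \<times> real \<times> real \<Rightarrow> real) \<Rightarrow> bool" where
  "invariant_on Q \<Omega> u \<longleftrightarrow> locally_invariant Q (graph_on \<Omega> u)"

text \<open>\<open>F\<close> (a function of the base variables) is an invariant of the group over \<open>\<Omega>\<close>.\<close>

definition group_invariant ::
  "(R4 \<Rightarrow> R4) \<Rightarrow> (real \<times> real \<times> real) set \<Rightarrow> (real \<times> real \<times> real \<Rightarrow> 'b) \<Rightarrow> bool" where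
  "group_invariant Q \<Omega> F \<longleftrightarrow>
     (\<forall>\<gamma> a b. integral_curve Q {a<..<b} \<gamma> \<longrightarrow>
        (\<forall>s\<in>{a<..<b}. (\<lambda>(t, x, y, v). (t, x, y)) (\<gamma> s) \<in> \<Omega>) \<longrightarrow>
        (\<lambda>s. F ((\<lambda>(t, x, y, v). (t, x, y)) (\<gamma> s))) constant_on {a<..<b})"

section \<open>The reduction formula\<close>

text \<open>With the normalisation of \<open>yfield\<close> above, \<open>zvar k0 g h\<close> and \<open>ansatz k0 g h\<close> belong to the
  generator \<open>k\<^sub>0v\<^sub>0 + x\<^sub>g + y\<^sub>2\<^sub>h\<close>, not \<open>k\<^sub>0v\<^sub>0 + x\<^sub>g + y\<^sub>h\<close>: the \<open>y\<close>-component of the generator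
  must be \<open>2h + k\<^sub>0y\<close>. For \<open>k\<^sub>0 = 1, g = 0, h = 1\<close>, the field \<open>k\<^sub>0v\<^sub>0 + x\<^sub>g + y\<^sub>h\<close> does not leave
  \<open>z = x / (2 + y)\<^sup>2\<close> invariant.\<close>

definition zvar :: "real \<Rightarrow> (real \<Rightarrow> real) \<Rightarrow> (real \<Rightarrow> real) \<Rightarrow> real \<times> real \<times> real \<Rightarrow> real" where
  "zvar k0 g h = (\<lambda>(t, x, y).
     1 / (2 * h t + k0 * y)\<^sup>2 *
       (x + (k0 * g t + 2 * (h t + k0 * y) * deriv h t) / (2 * k0\<^sup>2)))"

definition rz :: "real \<Rightarrow> (real \<Rightarrow> real) \<Rightarrow> (real \<Rightarrow> real) \<Rightarrow> real \<times> real \<times> real \<Rightarrow> real \<times> real" where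
  "rz k0 g h p = (fst p, zvar k0 g h p)"

definition ansatz ::
  "real \<Rightarrow> (real \<Rightarrow> real) \<Rightarrow> (real \<Rightarrow> real) \<Rightarrow> (real \<times> real \<Rightarrow> real) \<Rightarrow> real \<times> real \<times> real \<Rightarrow> real" where
  "ansatz k0 g h w = (\<lambda>(t, x, y).
     (2 * h t + k0 * y)\<^sup>2 * w (t, zvar k0 g h (t, x, y))
     + (k0 * deriv g t + 2 * (h t + k0 * y) * deriv (deriv h) t) / (2 * k0\<^sup>2))"

text \<open>Regions on which the reduction formula is considered: \<open>z\<close> is defined there, and every
  fibre of \<open>(r, z)\<close> meets the region in a connected set, hence in a piece of a single orbit.
  Without the latter, a locally invariant \<open>u\<close> could need different \<open>w\<close> on different pieces of a
  fibre (for instance on the two sides of \<open>2h + k\<^sub>0y = 0\<close>). The half-spaces \<open>2h + k\<^sub>0y > 0\<close> and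
  \<open>2h + k\<^sub>0y < 0\<close> are such regions.\<close>

definition reduction_region ::
  "real \<Rightarrow> (real \<Rightarrow> real) \<Rightarrow> (real \<Rightarrow> real) \<Rightarrow> real set \<Rightarrow> (real \<times> real \<times> real) set \<Rightarrow> bool" where
  "reduction_region k0 g h J \<Omega> \<longleftrightarrow>
     open \<Omega> \<and>
     (\<forall>(t, x, y)\<in>\<Omega>. t \<in> J \<and> 2 * h t + k0 * y \<noteq> 0) \<and>
     (\<forall>c. connected {p \<in> \<Omega>. rz k0 g h p = c})"

end

(* Along the flow of the generator, s = 2h + k_0 y grows like exp(k_0 eps) while t is constant, and
   both z and (u - A) / s^2, where A is the inhomogeneous term of the reduction formula, are constant.
   So on each fibre of (r, z), which y parametrises over an open interval, an invariant u is
   determined by one value w = (u - A) / s^2; smoothness of w is read off along the local sections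
   y = const of (r, z). The reduced equation is then a chain rule computation. *)

theory Submission
  imports Defs
begin

section \<open>Calculus of smooth functions\<close>

text \<open>Local invariance keeps a point in the graph only for a short time. It is therefore used
  only through its derivative at parameter 0, a first-order linear equation for \<open>u\<close>.
  This equation is integrated along the fibre itself, so short integral curves never have to be
  pieced together. The sections are local because no single height y need meet every fibre. Partial
  derivatives are one-variable \<open>deriv\<close>s, while smoothness speaks of total derivatives
  and the formulas for \<open>u\<close> hold on \<open>\<Omega>\<close> only. Passing between these
  notions relies on openness throughout.\<close>

lemma Ck_on_cong:
  assumes "open S" "\<And>p. p \<in> S \<Longrightarrow> f p = f' p" "Ck_on n S f"
  shows "Ck_on n S f'"
  using assms(2,3)
proof (induction n arbitrary: f f')
  case 0
  then show ?case by (simp cong: continuous_on_cong)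
next
  case (Suc n)
  \<comment> \<open>A derivative depends only on values near the point, and openness of
    \<open>S\<close> turns agreement on \<open>S\<close> into agreement near each of its
    points.\<close>
  have der: "(f' has_derivative frechet_derivative f (at p)) (at p)" if "p \<in> S" for p
  proof -
    have "(f has_derivative frechet_derivative f (at p)) (at p)"
      using Suc.prems that by (simp add: frechet_derivative_works)
    then show ?thesis
      by (rule has_derivative_transform_within_open[OF _ \<open>open S\<close> that]) (use Suc.prems in auto)
  qed
  have eq: "frechet_derivative f (at p) = frechet_derivative f' (at p)" if "p \<in> S" for p
    using der[OF that] by (rule frechet_derivative_at)
  have "Ck_on n S (\<lambda>p. frechet_derivative f' (at p) v)" for v
    by (rule Suc.IH[of "\<lambda>p. frechet_derivative f (at p) v"]) (use Suc.prems eq in auto)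
  then show ?case
    using der by (auto simp: differentiable_def)
qed

text \<open>Uniqueness of the derivative makes any explicit formula for it as good as
  \<open>frechet_derivative\<close>, so the closure rules below only have to inspect such
  formulas.\<close>

lemma Ck_on_SucI:
  assumes "open S" "\<And>p. p \<in> S \<Longrightarrow> (f has_derivative f' p) (at p)"
    and "\<And>v. Ck_on n S (\<lambda>p. f' p v)"
  shows "Ck_on (Suc n) S f"
proof -
  have "Ck_on n S (\<lambda>p. frechet_derivative f (at p) v)" for v
    by (rule Ck_on_cong[OF assms(1) _ assms(3)])
       (use frechet_derivative_at[OF assms(2)] in auto)
  then show ?thesis
    using assms(2) by (auto simp: differentiable_def)
qed

lemma Ck_on_has_derivative:
  "Ck_on (Suc n) S f \<Longrightarrow> p \<in> S \<Longrightarrow> (f has_derivative frechet_derivative f (at p)) (at p)"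
  by (simp add: frechet_derivative_works)

lemma Ck_on_SucD: "Ck_on (Suc n) S f \<Longrightarrow> Ck_on n S f"
proof (induction n arbitrary: f)
  case 0
  then show ?case
    by (auto intro!: continuous_at_imp_continuous_on differentiable_imp_continuous_within)
next
  case (Suc n)
  then show ?case by (metis Ck_on.simps(2))
qed

lemma Ck_on_subset: "Ck_on n S f \<Longrightarrow> T \<subseteq> S \<Longrightarrow> Ck_on n T f"
  by (induction n arbitrary: f) (auto intro: continuous_on_subset)

text \<open>Continuity on open sets and differentiability are conditions at single points, so local
  pieces glue. This serves for \<open>w\<close>, whose smoothness is visible only near each point,
  through a section that varies with the point.\<close>

lemma Ck_on_local:
  assumes "\<And>p. p \<in> S \<Longrightarrow> \<exists>U. open U \<and> p \<in> U \<and> Ck_on n U f"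
  shows "Ck_on n S f"
  using assms
proof (induction n arbitrary: f)
  case 0
  show ?case
    unfolding Ck_on.simps
    by (metis "0" Ck_on.simps(1) continuous_at_imp_continuous_on continuous_on_eq_continuous_at)
next
  case (Suc n)
  then show ?case
    unfolding Ck_on.simps(2) by metis
qed

lemma Ck_on_const: "open S \<Longrightarrow> Ck_on n S (\<lambda>p. c)"
proof (induction n arbitrary: c)
  case (Suc n)
  show ?case
    by (rule Ck_on_SucI[where f' = "\<lambda>p v. 0"]) (use Suc in auto)
qed simp

lemma Ck_on_bounded_linear:
  assumes "open S" "bounded_linear f"
  shows "Ck_on n S f"
proof (cases n)
  case 0
  then show ?thesis
    using assms by (auto intro: linear_continuous_on)
next
  case (Suc m)
  show ?thesis unfolding Suc
    by (rule Ck_on_SucI[where f' = "\<lambda>p. f"])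
       (use assms in \<open>auto intro: bounded_linear_imp_has_derivative Ck_on_const\<close>)
qed

lemma Ck_on_add:
  assumes "open S" "Ck_on n S f" "Ck_on n S f'"
  shows "Ck_on n S (\<lambda>p. f p + f' p)"
  using assms(2,3)
proof (induction n arbitrary: f f')
  case (Suc n)
  show ?case
  proof (rule Ck_on_SucI)
    show "((\<lambda>p. f p + f' p) has_derivative
        (\<lambda>v. frechet_derivative f (at p) v + frechet_derivative f' (at p) v)) (at p)"
      if "p \<in> S" for p
      using Suc.prems[THEN Ck_on_has_derivative, OF that] by (intro has_derivative_add)
  qed (use Suc assms in auto)
qed (auto intro: continuous_on_add)

lemma Ck_on_mult:
  assumes "open S" "Ck_on n S f" "Ck_on n S f'"
  shows "Ck_on n S (\<lambda>p. f p * f' p)"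
  using assms(2,3)
proof (induction n arbitrary: f f')
  case (Suc n)
  show ?case
  proof (rule Ck_on_SucI)
    show "((\<lambda>p. f p * f' p) has_derivative
        (\<lambda>v. f p * frechet_derivative f' (at p) v + frechet_derivative f (at p) v * f' p)) (at p)"
      if "p \<in> S" for p
      using Suc.prems[THEN Ck_on_has_derivative, OF that] by (intro has_derivative_mult)
    show "Ck_on n S (\<lambda>p. f p * frechet_derivative f' (at p) v + frechet_derivative f (at p) v * f' p)" for v
      by (intro Ck_on_add Suc.IH assms Suc.prems[THEN Ck_on_SucD]) (use Suc.prems in auto)
  qed (use assms in auto)
qed (auto intro: continuous_on_mult)

lemma Ck_on_sum:
  assumes "open S" "\<And>i. i \<in> I \<Longrightarrow> Ck_on n S (f i)"
  shows "Ck_on n S (\<lambda>p. \<Sum>i\<in>I. f i p)"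
  using assms(2)
  by (induction I rule: infinite_finite_induct) (auto intro: Ck_on_const Ck_on_add assms(1))

text \<open>The derivative is a product containing the reciprocal again, now needed to one order
  less, so the induction closes.\<close>

lemma Ck_on_inverse:
  assumes "open S" "Ck_on n S f" "\<And>p. p \<in> S \<Longrightarrow> f p \<noteq> 0"
  shows "Ck_on n S (\<lambda>p. inverse (f p))"
  using assms(2)
proof (induction n)
  case 0
  then show ?case using assms(3) by (auto intro: continuous_on_inverse)
next
  case (Suc n)
  show ?case
  proof (rule Ck_on_SucI)
    show "((\<lambda>p. inverse (f p)) has_derivative
        (\<lambda>v. (-1) * (inverse (f p) * frechet_derivative f (at p) v * inverse (f p)))) (at p)"
      if "p \<in> S" for p
      using Deriv.has_derivative_inverse[OF assms(3)[OF that] Suc.prems[THEN Ck_on_has_derivative, OF that]]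
      by simp
    show "Ck_on n S (\<lambda>p. (-1) * (inverse (f p) * frechet_derivative f (at p) v * inverse (f p)))" for v
      by (intro Ck_on_mult Ck_on_const assms(1) Suc.IH Suc.prems[THEN Ck_on_SucD]) (use Suc.prems in auto)
  qed (use assms in auto)
qed

text \<open>Since \<open>Ck_on\<close> concerns real-valued functions, the inner map is handled by
  components. Expanding its derivative over \<open>Basis\<close> writes the derivative of the
  composite as a sum of products, to which the induction hypothesis applies through the directional
  derivatives of \<open>f\<close>.\<close>

lemma Ck_on_compose:
  fixes F :: "'a::euclidean_space \<Rightarrow> 'b::euclidean_space"
  assumes "open S" "open T" "F ` S \<subseteq> T"
    and "Ck_on n T f" "\<And>b. b \<in> Basis \<Longrightarrow> Ck_on n S (\<lambda>p. F p \<bullet> b)"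
  shows "Ck_on n S (\<lambda>p. f (F p))"
  using assms(4,5)
proof (induction n arbitrary: f)
  case 0
  then have "continuous_on S F"
    by (auto intro: continuous_on_componentwise[THEN iffD2])
  with 0 show ?case
    using assms(3) by (auto intro: continuous_on_compose2)
next
  case (Suc n)
  define DF where "DF b p = frechet_derivative (\<lambda>q. F q \<bullet> b) (at p)" for b p
  have DF: "((\<lambda>q. F q \<bullet> b) has_derivative DF b p) (at p)" if "p \<in> S" "b \<in> Basis" for p b
    unfolding DF_def using Ck_on_has_derivative[OF Suc.prems(2)] that by auto
  have F: "(F has_derivative (\<lambda>v. \<Sum>b\<in>Basis. DF b p v *\<^sub>R b)) (at p)" if "p \<in> S" for p
    unfolding has_derivative_componentwise_within[of F]
  proof
    fix b :: 'b assume "b \<in> Basis"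
    then show "((\<lambda>x. F x \<bullet> b) has_derivative (\<lambda>x. (\<Sum>b\<in>Basis. DF b p x *\<^sub>R b) \<bullet> b)) (at p)"
      using DF[OF that] by simp
  qed
  show ?case
  proof (rule Ck_on_SucI)
    fix p assume p: "p \<in> S"
    then have f: "(f has_derivative frechet_derivative f (at (F p))) (at (F p))"
      using assms(3) Ck_on_has_derivative[OF Suc.prems(1)] by auto
    have "((\<lambda>q. f (F q)) has_derivative
        (\<lambda>v. frechet_derivative f (at (F p)) (\<Sum>b\<in>Basis. DF b p v *\<^sub>R b))) (at p)"
      by (rule has_derivative_compose[OF F[OF p] f])
    moreover have "frechet_derivative f (at (F p)) (\<Sum>b\<in>Basis. DF b p v *\<^sub>R b) =
        (\<Sum>b\<in>Basis. DF b p v * frechet_derivative f (at (F p)) b)" for v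
      using has_derivative_linear[OF f] by (simp add: linear_sum linear_scale)
    ultimately show "((\<lambda>q. f (F q)) has_derivative
        (\<lambda>v. \<Sum>b\<in>Basis. DF b p v * frechet_derivative f (at (F p)) b)) (at p)"
      by simp
  next
    fix v
    show "Ck_on n S (\<lambda>p. \<Sum>b\<in>Basis. DF b p v * frechet_derivative f (at (F p)) b)"
    proof (intro Ck_on_sum Ck_on_mult assms(1))
      fix b :: 'b assume b: "b \<in> Basis"
      then show "Ck_on n S (\<lambda>p. DF b p v)"
        unfolding DF_def using Suc.prems by auto
      show "Ck_on n S (\<lambda>p. frechet_derivative f (at (F p)) b)"
        by (rule Suc.IH[OF _ Ck_on_SucD[OF Suc.prems(2)]]) (use Suc.prems(1) in auto)
    qed
  qed (rule assms(1))
qed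

lemma smooth_onD:
  "smooth_on S f \<Longrightarrow> p \<in> S \<Longrightarrow> (f has_derivative frechet_derivative f (at p)) (at p)"
  unfolding smooth_on_def by (metis Ck_on_has_derivative)

lemma smooth_on_directional:
  "smooth_on S f \<Longrightarrow> smooth_on S (\<lambda>p. frechet_derivative f (at p) v)"
  unfolding smooth_on_def by (metis Ck_on.simps(2))

lemma smooth_on_cong:
  "open S \<Longrightarrow> (\<And>p. p \<in> S \<Longrightarrow> f p = f' p) \<Longrightarrow> smooth_on S f \<Longrightarrow> smooth_on S f'"
  unfolding smooth_on_def by (metis Ck_on_cong)

lemma smooth_on_DERIV:
  fixes f :: "real \<Rightarrow> real"
  assumes "smooth_on S f" "p \<in> S"
  shows "(f has_real_derivative deriv f p) (at p)"
  using smooth_onD[OF assms]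
  by (metis DERIV_deriv_iff_real_differentiable differentiableI)

lemma smooth_on_deriv:
  fixes f :: "real \<Rightarrow> real"
  assumes "open S" "smooth_on S f"
  shows "smooth_on S (deriv f)"
proof (rule smooth_on_cong[OF assms(1) _ smooth_on_directional[OF assms(2), of 1]])
  fix p assume "p \<in> S"
  then have "(f has_derivative (\<lambda>v. deriv f p * v)) (at p)"
    using smooth_on_DERIV[OF assms(2)] by (simp add: has_field_derivative_def)
  from frechet_derivative_at[OF this]
  show "frechet_derivative f (at p) 1 = deriv f p" by (metis mult.right_neutral)
qed

section \<open>Partial derivatives\<close>

text \<open>This links total derivatives to one-variable ones, by expanding the velocity of the
  curve in the two unit vectors. Coordinate lines as curves then identify \<open>w' (1, 0)\<close>
  and \<open>w' (0, 1)\<close> with the partial derivatives.\<close>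

lemma has_derivative_Pair_chain:
  fixes w :: "real \<times> real \<Rightarrow> real"
  assumes "(w has_derivative w') (at (a s, b s))"
    and "(a has_real_derivative a') (at s)" "(b has_real_derivative b') (at s)"
  shows "((\<lambda>s. w (a s, b s)) has_real_derivative w' (1, 0) * a' + w' (0, 1) * b') (at s)"
proof -
  have "((\<lambda>s. (a s, b s)) has_derivative (\<lambda>v. (a' * v, b' * v))) (at s)"
    using assms(2,3) by (auto intro!: has_derivative_Pair simp: has_field_derivative_def)
  from has_derivative_compose[OF this assms(1)]
  have "((\<lambda>s. w (a s, b s)) has_derivative (\<lambda>v. w' (a' * v, b' * v))) (at s)" .
  moreover have "w' (a' * v, b' * v) = (w' (1, 0) * a' + w' (0, 1) * b') * v" for v
  proof -
    interpret linear w' using assms(1) by (rule has_derivative_linear)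
    have "(a' * v, b' * v) = (a' * v) *\<^sub>R (1, 0) + (b' * v) *\<^sub>R (0, 1)" by simp
    then show ?thesis by (simp add: add scale algebra_simps del: scaleR_Pair)
  qed
  ultimately show ?thesis by (simp add: has_field_derivative_def)
qed

lemma frechet_derivative_eq_Wt: "smooth_on R w \<Longrightarrow> q \<in> R \<Longrightarrow> frechet_derivative w (at q) (1, 0) = Wt w q"
  using has_derivative_Pair_chain[OF smooth_onD, of R w "\<lambda>s. s" "fst q" "\<lambda>s. snd q" 1 0]
  by (cases q) (auto simp: Wt_def dest!: DERIV_imp_deriv)

lemma frechet_derivative_eq_Wz: "smooth_on R w \<Longrightarrow> q \<in> R \<Longrightarrow> frechet_derivative w (at q) (0, 1) = Wz w q"
  using has_derivative_Pair_chain[OF smooth_onD, of R w "\<lambda>s. fst q" "snd q" "\<lambda>s. s" 0 1]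
  by (cases q) (auto simp: Wz_def dest!: DERIV_imp_deriv)

lemma smooth_on_chain:
  assumes "smooth_on R w" "(a s, b s) \<in> R"
    and "(a has_real_derivative a') (at s)" "(b has_real_derivative b') (at s)"
  shows "((\<lambda>s. w (a s, b s)) has_real_derivative Wt w (a s, b s) * a' + Wz w (a s, b s) * b') (at s)"
  using has_derivative_Pair_chain[OF smooth_onD[OF assms(1,2)] assms(3,4)]
  by (simp add: frechet_derivative_eq_Wt[OF assms(1,2)] frechet_derivative_eq_Wz[OF assms(1,2)])

lemma smooth_on_Wz: "open R \<Longrightarrow> smooth_on R w \<Longrightarrow> smooth_on R (Wz w)"
  by (rule smooth_on_cong[OF _ _ smooth_on_directional[of R w "(0, 1)"]]) (auto simp: frechet_derivative_eq_Wz)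

lemma deriv_eq_openI:
  fixes f f' :: "real \<Rightarrow> real"
  assumes "open S" "s \<in> S" "\<And>r. r \<in> S \<Longrightarrow> f r = f' r" "(f' has_real_derivative d) (at s)"
  shows "deriv f s = d"
  by (rule DERIV_imp_deriv[OF has_field_derivative_transform_within_open[OF assms(4,1,2)]])
     (simp add: assms(3))

text \<open>In iterated partial derivatives the inner one has a known formula on
  \<open>\<Omega>\<close> only. Lines parallel to the axes meet \<open>\<Omega>\<close> in open
  sets, so differentiating the formula is legitimate.\<close>

lemma
  assumes "open \<Omega>" "(t, x, y) \<in> \<Omega>" "\<And>q. q \<in> \<Omega> \<Longrightarrow> u q = u' q"
  shows Dt_eqI: "((\<lambda>s. u' (s, x, y)) has_real_derivative d) (at t) \<Longrightarrow> Dt u (t, x, y) = d"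
    and Dx_eqI: "((\<lambda>s. u' (t, s, y)) has_real_derivative d) (at x) \<Longrightarrow> Dx u (t, x, y) = d"
    and Dy_eqI: "((\<lambda>s. u' (t, x, s)) has_real_derivative d) (at y) \<Longrightarrow> Dy u (t, x, y) = d"
proof -
  have op: "open (f -` \<Omega>)" if "continuous_on UNIV f" for f :: "real \<Rightarrow> _"
    using that assms(1) by (simp add: open_vimage)
  note * = deriv_eq_openI[OF op[of "\<lambda>s. (s, x, y)"]] deriv_eq_openI[OF op[of "\<lambda>s. (t, s, y)"]]
    deriv_eq_openI[OF op[of "\<lambda>s. (t, x, s)"]]
  show "((\<lambda>s. u' (s, x, y)) has_real_derivative d) (at t) \<Longrightarrow> Dt u (t, x, y) = d"
    unfolding Dt_def prod.case using assms(2,3)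
    by (intro *(1)) (auto intro!: continuous_intros)
  show "((\<lambda>s. u' (t, s, y)) has_real_derivative d) (at x) \<Longrightarrow> Dx u (t, x, y) = d"
    unfolding Dx_def prod.case using assms(2,3)
    by (intro *(2)) (auto intro!: continuous_intros)
  show "((\<lambda>s. u' (t, x, s)) has_real_derivative d) (at y) \<Longrightarrow> Dy u (t, x, y) = d"
    unfolding Dy_def prod.case using assms(2,3)
    by (intro *(3)) (auto intro!: continuous_intros)
qed

lemma
  assumes "open \<Omega>" "\<And>q. q \<in> \<Omega> \<Longrightarrow> u q = u' q" "p \<in> \<Omega>"
  shows Dt_cong: "Dt u p = Dt u' p" and Dx_cong: "Dx u p = Dx u' p" and Dy_cong: "Dy u p = Dy u' p"
proof -
  have ev: "eventually (\<lambda>s. u (f s) = u' (f s)) (nhds r)"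
    if "continuous_on UNIV f" "f r \<in> \<Omega>" for f :: "real \<Rightarrow> _" and r
    unfolding eventually_nhds using assms(1,2) that
    by (intro exI[of _ "f -` \<Omega>"]) (auto simp: open_vimage)
  show "Dt u p = Dt u' p" "Dx u p = Dx u' p" "Dy u p = Dy u' p"
    using assms(3)
    by (cases p; force simp: Dt_def Dx_def Dy_def
        intro!: deriv_cong_ev ev[of "\<lambda>s. (s, _, _)"] ev[of "\<lambda>s. (_, s, _)"] ev[of "\<lambda>s. (_, _, s)"]
          continuous_intros)+
qed

text \<open>An invariant \<open>u\<close> coincides with its reduction formula on
  \<open>\<Omega>\<close> alone. The first partial derivatives then agree on all of
  \<open>\<Omega>\<close>, hence so do the second ones.\<close>

lemma zk_cong:
  assumes "open \<Omega>" "\<And>q. q \<in> \<Omega> \<Longrightarrow> u q = u' q" "p \<in> \<Omega>"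
  shows "zk u p = zk u' p"
proof -
  note D = Dt_cong[OF assms(1) _ assms(3)] Dx_cong[OF assms(1) _ assms(3)]
    Dy_cong[OF assms(1) _ assms(3)]
  note D1 = Dx_cong[OF assms(1,2)] Dy_cong[OF assms(1,2)]
  show ?thesis
    unfolding zk_def
    using D(1)[of "Dx u" "Dx u'"] D(2)[of "\<lambda>q. u q * Dx u q" "\<lambda>q. u' q * Dx u' q"]
      D(3)[of "Dy u" "Dy u'"] D1 assms(2) by simp
qed

section \<open>The reduction\<close>

locale zk_reduction =
  fixes k0 :: real and g h :: "real \<Rightarrow> real" and J :: "real set"
    and \<Omega> :: "(real \<times> real \<times> real) set"
  assumes k0: "k0 \<noteq> 0"
    and J: "open J"
    and g: "smooth_on J g" and h: "smooth_on J h"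
    and region: "reduction_region k0 g h J \<Omega>"
begin

text \<open>These are the coordinates that centre and diagonalise the generator for fixed t:
  \<open>yscale\<close> is s, \<open>ushift\<close> is A, and along the flow s,
  \<open>x + xshift\<close> and \<open>u - ushift\<close> grow at the rates k0, 2 k0 and 2 k0. The
  quotients of the last two by s^2 are the invariants.\<close>

definition yscale :: "real \<Rightarrow> real \<Rightarrow> real" where
  "yscale t y = 2 * h t + k0 * y"

definition xshift :: "real \<Rightarrow> real \<Rightarrow> real" where
  "xshift t y = (k0 * g t + 2 * (h t + k0 * y) * deriv h t) / (2 * k0\<^sup>2)"

definition ushift :: "real \<Rightarrow> real \<Rightarrow> real" where
  "ushift t y = (k0 * deriv g t + 2 * (h t + k0 * y) * deriv (deriv h) t) / (2 * k0\<^sup>2)"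

lemma zvar_eq: "zvar k0 g h (t, x, y) = (x + xshift t y) / (yscale t y)\<^sup>2"
  by (simp add: zvar_def xshift_def yscale_def)

lemma ansatz_eq:
  "ansatz k0 g h w (t, x, y) = (yscale t y)\<^sup>2 * w (t, zvar k0 g h (t, x, y)) + ushift t y"
  by (simp add: ansatz_def ushift_def yscale_def)

lemma rz_eq: "rz k0 g h (t, x, y) = (t, zvar k0 g h (t, x, y))"
  by (simp add: rz_def)

lemma open_\<Omega>: "open \<Omega>"
  using region by (simp add: reduction_region_def)

lemma \<Omega>D: "(t, x, y) \<in> \<Omega> \<Longrightarrow> t \<in> J" "(t, x, y) \<in> \<Omega> \<Longrightarrow> yscale t y \<noteq> 0"
  using region by (auto simp: reduction_region_def yscale_def)

lemmas g' = smooth_on_deriv[OF J g] and h' = smooth_on_deriv[OF J h]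
lemmas h'' = smooth_on_deriv[OF J h']

lemmas DERIV_coeffs =
  smooth_on_DERIV[OF g] smooth_on_DERIV[OF h] smooth_on_DERIV[OF h']

lemma yscale_DERIV_y [derivative_intros]:
  "(Y has_real_derivative d) (at s) \<Longrightarrow> ((\<lambda>s. yscale t (Y s)) has_real_derivative k0 * d) (at s)"
  unfolding yscale_def by (auto intro!: derivative_eq_intros)

lemma xshift_DERIV_y [derivative_intros]:
  "(Y has_real_derivative d) (at s) \<Longrightarrow>
     ((\<lambda>s. xshift t (Y s)) has_real_derivative deriv h t / k0 * d) (at s)"
  unfolding xshift_def using k0
  by (auto intro!: derivative_eq_intros simp: power2_eq_square field_simps)

lemma ushift_DERIV_y [derivative_intros]:
  "(Y has_real_derivative d) (at s) \<Longrightarrow>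
     ((\<lambda>s. ushift t (Y s)) has_real_derivative deriv (deriv h) t / k0 * d) (at s)"
  unfolding ushift_def using k0
  by (auto intro!: derivative_eq_intros simp: power2_eq_square field_simps)

lemma yscale_DERIV_t:
  "t \<in> J \<Longrightarrow> ((\<lambda>t. yscale t y) has_real_derivative 2 * deriv h t) (at t)"
  unfolding yscale_def by (auto intro!: derivative_eq_intros DERIV_coeffs)

text \<open>The two inhomogeneous terms are coupled: up to a term free of y, A is the time
  derivative of the shift of x. This is what lets A drop out of the substituted equation.\<close>

lemma xshift_DERIV_t:
  "t \<in> J \<Longrightarrow>
     ((\<lambda>t. xshift t y) has_real_derivative ushift t y + (deriv h t)\<^sup>2 / k0\<^sup>2) (at t)"
  unfolding xshift_def ushift_def using k0
  by (auto intro!: derivative_eq_intros DERIV_coeffs simp: power2_eq_square field_simps)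

lemma zvar_DERIV_x:
  assumes "(t, x, y) \<in> \<Omega>"
  shows "((\<lambda>x. zvar k0 g h (t, x, y)) has_real_derivative 1 / (yscale t y)\<^sup>2) (at x)"
  unfolding zvar_eq using \<Omega>D[OF assms]
  by (auto intro!: derivative_eq_intros simp: power2_eq_square field_simps)

text \<open>The last term is kept in terms of z itself, so that the second y-derivative can reuse
  the same formula.\<close>

lemma zvar_DERIV_y:
  assumes "(t, x, y) \<in> \<Omega>"
  shows "((\<lambda>y. zvar k0 g h (t, x, y)) has_real_derivative
    deriv h t / (k0 * (yscale t y)\<^sup>2) - 2 * k0 * zvar k0 g h (t, x, y) / yscale t y) (at y)"
  unfolding zvar_eq using \<Omega>D[OF assms] k0
  by (auto intro!: derivative_eq_intros simp: power2_eq_square field_simps)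

lemma zvar_DERIV_t:
  assumes "(t, x, y) \<in> \<Omega>"
  shows "((\<lambda>t. zvar k0 g h (t, x, y)) has_real_derivative
    (ushift t y + (deriv h t)\<^sup>2 / k0\<^sup>2) / (yscale t y)\<^sup>2
      - 4 * deriv h t * zvar k0 g h (t, x, y) / yscale t y) (at t)"
  unfolding zvar_eq using \<Omega>D[OF assms] k0
  by (auto intro!: derivative_eq_intros yscale_DERIV_t xshift_DERIV_t
      simp: power2_eq_square field_simps)

text \<open>\<open>fibre y\<close> is the section of \<open>(r, z)\<close> at height \<open>y\<close>; for fixed \<open>(t, z)\<close>,
  \<open>y \<mapsto> fibre y (t, z)\<close> parametrises the fibre over \<open>(t, z)\<close>.\<close>

definition fibre :: "real \<Rightarrow> real \<times> real \<Rightarrow> real \<times> real \<times> real" where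
  "fibre y = (\<lambda>(t, z). (t, (yscale t y)\<^sup>2 * z - xshift t y, y))"

lemma fibre_rz: "(t, x, y) \<in> \<Omega> \<Longrightarrow> fibre y (rz k0 g h (t, x, y)) = (t, x, y)"
  using \<Omega>D by (auto simp: fibre_def rz_eq zvar_eq)

lemma rz_fibre: "fibre y q \<in> \<Omega> \<Longrightarrow> rz k0 g h (fibre y q) = q"
  using \<Omega>D by (auto simp: fibre_def rz_eq zvar_eq split: prod.splits)

section \<open>Smooth local sections of the invariants, and openness of their image\<close>

lemma smooth_on_fst:
  assumes "smooth_on J f" shows "Ck_on n (J \<times> (UNIV :: real set)) (\<lambda>q. f (fst q))"
  by (rule Ck_on_compose[of _ J]) (use assms J in
      \<open>auto simp: smooth_on_def open_Times intro: Ck_on_bounded_linear bounded_linear_fst\<close>)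

lemma Ck_on_coeffs:
  "Ck_on n (J \<times> (UNIV :: real set)) (\<lambda>q. yscale (fst q) y)"
  "Ck_on n (J \<times> (UNIV :: real set)) (\<lambda>q. xshift (fst q) y)"
  "Ck_on n (J \<times> (UNIV :: real set)) (\<lambda>q. ushift (fst q) y)"
  unfolding yscale_def xshift_def ushift_def divide_inverse
  by (intro Ck_on_add Ck_on_mult Ck_on_const open_Times J open_UNIV
      smooth_on_fst[OF g] smooth_on_fst[OF g'] smooth_on_fst[OF h] smooth_on_fst[OF h']
      smooth_on_fst[OF h''])+

lemma Ck_on_fibre:
  assumes "b \<in> Basis" shows "Ck_on n (J \<times> UNIV) (\<lambda>q. fibre y q \<bullet> b)"
proof -
  have op: "open (J \<times> (UNIV :: real set))" using J by (simp add: open_Times)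
  have "Ck_on n (J \<times> UNIV) (\<lambda>q. (yscale (fst q) y)\<^sup>2 * snd q + (-1) * xshift (fst q) y)"
    unfolding power2_eq_square
    by (intro Ck_on_add Ck_on_mult Ck_on_const op Ck_on_coeffs Ck_on_bounded_linear bounded_linear_snd)
  moreover have "Ck_on n (J \<times> (UNIV :: real set)) fst"
    by (intro op Ck_on_bounded_linear bounded_linear_fst)
  ultimately show ?thesis
    using assms op
    by (auto simp: Basis_prod_def fibre_def case_prod_beta Ck_on_const)
qed

definition fibre_dom :: "real \<Rightarrow> (real \<times> real) set" where
  "fibre_dom y = {q. fibre y q \<in> \<Omega>}"

text \<open>The section is continuous over \<open>J\<close>, where the coefficients are smooth. As
  \<open>\<Omega>\<close> lies over \<open>J\<close>, intersecting with
  \<open>J \<times> UNIV\<close> loses nothing.\<close>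

lemma fibre_dom_eq: "fibre_dom y = (J \<times> UNIV) \<inter> fibre y -` \<Omega>"
  using \<Omega>D(1) by (auto simp: fibre_dom_def fibre_def)

lemma open_fibre_dom: "open (fibre_dom y)"
  unfolding fibre_dom_eq
proof (rule continuous_open_preimage[OF _ _ open_\<Omega>])
  show "continuous_on (J \<times> UNIV) (fibre y)"
    using Ck_on_fibre[of _ 0 y] by (auto intro: continuous_on_componentwise[THEN iffD2])
qed (use J in \<open>simp add: open_Times\<close>)

text \<open>A point of the image comes from some point of \<open>\<Omega>\<close>, whose height y
  selects a section through it. The cover by domains of sections yields openness of the image and,
  near each point, a smooth right inverse of \<open>rz\<close>.\<close>

lemma rz_image: "rz k0 g h ` \<Omega> = (\<Union>y. fibre_dom y)"
proof (intro equalityI subsetI)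
  fix q assume "q \<in> rz k0 g h ` \<Omega>"
  then obtain t x y where "(t, x, y) \<in> \<Omega>" "q = rz k0 g h (t, x, y)" by auto
  then show "q \<in> (\<Union>y. fibre_dom y)" by (auto simp: fibre_dom_def fibre_rz intro!: exI[of _ y])
next
  fix q assume "q \<in> (\<Union>y. fibre_dom y)"
  then show "q \<in> rz k0 g h ` \<Omega>" by (force simp: fibre_dom_def dest: rz_fibre)
qed

lemma open_rz_image: "open (rz k0 g h ` \<Omega>)"
  unfolding rz_image by (auto intro: open_fibre_dom)

section \<open>Substitution of the reduction formula in the ZK equation\<close>

lemma
  assumes w: "smooth_on (rz k0 g h ` \<Omega>) w" and p: "(t, x, y) \<in> \<Omega>"
  defines "z \<equiv> zvar k0 g h (t, x, y)"
  shows profile_DERIV_x: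
      "((\<lambda>x. w (t, zvar k0 g h (t, x, y))) has_real_derivative Wz w (t, z) / (yscale t y)\<^sup>2) (at x)"
    and profile_DERIV_y:
      "((\<lambda>y. w (t, zvar k0 g h (t, x, y))) has_real_derivative
         Wz w (t, z) * (deriv h t / (k0 * (yscale t y)\<^sup>2) - 2 * k0 * z / yscale t y)) (at y)"
    and profile_DERIV_t:
      "((\<lambda>t. w (t, zvar k0 g h (t, x, y))) has_real_derivative Wt w (t, z) +
         Wz w (t, z) * ((ushift t y + (deriv h t)\<^sup>2 / k0\<^sup>2) / (yscale t y)\<^sup>2
           - 4 * deriv h t * z / yscale t y)) (at t)"
proof -
  have mem: "(t, zvar k0 g h (t, x, y)) \<in> rz k0 g h ` \<Omega>"
    using p rz_eq by (metis image_eqI)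
  show "((\<lambda>x. w (t, zvar k0 g h (t, x, y))) has_real_derivative Wz w (t, z) / (yscale t y)\<^sup>2) (at x)"
    using smooth_on_chain[OF w _ DERIV_const zvar_DERIV_x[OF p], of t] mem by (simp add: z_def)
  show "((\<lambda>y. w (t, zvar k0 g h (t, x, y))) has_real_derivative
         Wz w (t, z) * (deriv h t / (k0 * (yscale t y)\<^sup>2) - 2 * k0 * z / yscale t y)) (at y)"
    using smooth_on_chain[OF w _ DERIV_const zvar_DERIV_y[OF p], of t] mem by (simp add: z_def)
  show "((\<lambda>t. w (t, zvar k0 g h (t, x, y))) has_real_derivative Wt w (t, z) +
         Wz w (t, z) * ((ushift t y + (deriv h t)\<^sup>2 / k0\<^sup>2) / (yscale t y)\<^sup>2
           - 4 * deriv h t * z / yscale t y)) (at t)"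
    using smooth_on_chain[OF w _ DERIV_ident zvar_DERIV_t[OF p]] mem by (simp add: z_def)
qed

text \<open>The coefficient of w_zz is where the cancellation happens: A / s^2 from u_xt meets the
  same term from u u_xx, and the terms in h' from u_xt meet those of the square in u_yy. What
  survives is -(w + 4 k0^2 z^2).\<close>

lemma zk_ansatz:
  assumes w: "smooth_on (rz k0 g h ` \<Omega>) w" and p: "p \<in> \<Omega>"
  shows "zk (ansatz k0 g h w) p = reduced_zk k0 w (rz k0 g h p)"
proof -
  let ?U = "ansatz k0 g h w" and ?z = "zvar k0 g h"
  note wz = smooth_on_Wz[OF open_rz_image w]
  \<comment> \<open>The factor s^2 of the formula cancels the derivative 1 / s^2 of z. Hence u_xt
    and u_xx only need the chain rule for \<open>Wz w\<close>, again smooth on the open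
    image.\<close>
  have Dx: "Dx ?U q = Wz w (rz k0 g h q)" if "q \<in> \<Omega>" for q
  proof -
    obtain t x y where q: "q = (t, x, y)" by (cases q)
    note pt = that[unfolded q]
    show ?thesis unfolding q
      by (rule Dx_eqI[OF open_\<Omega> pt refl], unfold ansatz_eq rz_eq)
         (use \<Omega>D[OF pt] in \<open>auto intro!: derivative_eq_intros
            profile_DERIV_x[OF w pt]\<close>)
  qed
  have Dy: "Dy ?U q = (\<lambda>(t, x, y). 2 * k0 * yscale t y * w (t, ?z (t, x, y))
      + (deriv h t / k0 - 2 * k0 * yscale t y * ?z (t, x, y)) * Wz w (t, ?z (t, x, y))
      + deriv (deriv h) t / k0) q" if "q \<in> \<Omega>" for q
  proof -
    obtain t x y where q: "q = (t, x, y)" by (cases q)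
    note pt = that[unfolded q]
    show ?thesis unfolding q prod.case
      by (rule Dy_eqI[OF open_\<Omega> pt refl], unfold ansatz_eq)
         (use \<Omega>D[OF pt] k0 in \<open>auto intro!: derivative_eq_intros
            profile_DERIV_y[OF w pt] zvar_DERIV_y[OF pt]
            simp: power2_eq_square field_simps\<close>)
  qed
  obtain t x y where p_eq: "p = (t, x, y)" by (cases p)
  note pt = p[unfolded p_eq]
  define s z A a where "s = yscale t y" and "z = ?z (t, x, y)" and "A = ushift t y"
    and "a = deriv h t"
  note defs = s_def[symmetric] z_def[symmetric] A_def[symmetric] a_def[symmetric]
  have s: "s \<noteq> 0" using \<Omega>D[OF pt] by (simp add: s_def)
  have Dtx: "Dt (Dx ?U) (t, x, y) = Wt (Wz w) (t, z)
      + Wz (Wz w) (t, z) * ((A + a\<^sup>2 / k0\<^sup>2) / s\<^sup>2 - 4 * a * z / s)"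
    by (rule Dt_eqI[OF open_\<Omega> pt Dx], assumption, unfold rz_eq)
       (use profile_DERIV_t[OF wz pt] in
         \<open>simp add: defs\<close>)
  have Dxx: "Dx (\<lambda>q. ?U q * Dx ?U q) (t, x, y) =
      (Wz w (t, z))\<^sup>2 + (s\<^sup>2 * w (t, z) + A) * (Wz (Wz w) (t, z) / s\<^sup>2)"
    by (rule Dx_eqI[OF open_\<Omega> pt, where u' = "\<lambda>q. ?U q * Wz w (rz k0 g h q)"],
        simp add: Dx, unfold ansatz_eq rz_eq)
       (use s in \<open>auto intro!: derivative_eq_intros
          profile_DERIV_x[OF w pt] profile_DERIV_x[OF wz pt]
          simp: defs power2_eq_square\<close>)
  have Dyy: "Dy (Dy ?U) (t, x, y) = 2 * k0\<^sup>2 * w (t, z) - 2 * k0\<^sup>2 * z * Wz w (t, z)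
      + (a / (k0 * s) - 2 * k0 * z)\<^sup>2 * Wz (Wz w) (t, z)"
    by (rule Dy_eqI[OF open_\<Omega> pt Dy], assumption, unfold prod.case)
       (use s k0 in \<open>auto intro!: derivative_eq_intros
          profile_DERIV_y[OF w pt] profile_DERIV_y[OF wz pt] zvar_DERIV_y[OF pt]
          simp: defs power2_eq_square field_simps\<close>)
  show ?thesis
    unfolding zk_def p_eq Dtx Dxx Dyy rz_eq reduced_zk_def prod.case z_def[symmetric]
    using s k0 by (simp add: power2_eq_square field_simps)
qed

end

section \<open>Integral curves of the generator and infinitesimal invariance\<close>

lemma integral_curve_components:
  assumes "integral_curve Q I \<gamma>" "s \<in> I" "Q (\<gamma> s) = (a, b, c, d)"
  shows "((\<lambda>s. fst (\<gamma> s)) has_real_derivative a) (at s)"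
    and "((\<lambda>s. fst (snd (\<gamma> s))) has_real_derivative b) (at s)"
    and "((\<lambda>s. fst (snd (snd (\<gamma> s)))) has_real_derivative c) (at s)"
    and "((\<lambda>s. snd (snd (snd (\<gamma> s)))) has_real_derivative d) (at s)"
proof -
  have *: "(\<gamma> has_vector_derivative (a, b, c, d)) (at s)"
    using assms unfolding integral_curve_def by metis
  note fst' = bounded_linear.has_vector_derivative[OF bounded_linear_fst]
    and snd' = bounded_linear.has_vector_derivative[OF bounded_linear_snd]
  show "((\<lambda>s. fst (\<gamma> s)) has_real_derivative a) (at s)"
    "((\<lambda>s. fst (snd (\<gamma> s))) has_real_derivative b) (at s)"
    "((\<lambda>s. fst (snd (snd (\<gamma> s)))) has_real_derivative c) (at s)"
    "((\<lambda>s. snd (snd (snd (\<gamma> s)))) has_real_derivative d) (at s)"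
    using fst'[OF *] fst'[OF snd'[OF *]] fst'[OF snd'[OF snd'[OF *]]] snd'[OF snd'[OF snd'[OF *]]]
    by (simp_all add: has_real_derivative_iff_has_vector_derivative)
qed

lemma has_vector_derivative_Pair':
  assumes "(f has_vector_derivative f') (at s)" "(g has_vector_derivative g') (at s)"
  shows "((\<lambda>s. (f s, g s)) has_vector_derivative (f', g')) (at s)"
  using assms unfolding has_vector_derivative_def
  by (auto dest: has_derivative_Pair)

context zk_reduction
begin

abbreviation "Q \<equiv> generator k0 g (\<lambda>t. 2 * h t)"

text \<open>Doubling h cancels the halves in \<open>yfield\<close>. On the open set \<open>J\<close>
  the factor 2 can be pulled out of both derivatives.\<close>

lemma generator_eq:
  assumes "t \<in> J"
  shows "Q (t, x, y, v) = (0, 2 * k0 * x + g t + y * deriv h t, yscale t y,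
    2 * k0 * v - deriv g t - y * deriv (deriv h) t)"
proof -
  have 1: "deriv (\<lambda>t. 2 * h t) s = 2 * deriv h s" if "s \<in> J" for s
    using DERIV_imp_deriv[OF DERIV_cmult[OF smooth_on_DERIV[OF h that]]] .
  have "deriv (deriv (\<lambda>t. 2 * h t)) t = 2 * deriv (deriv h) t"
    by (rule deriv_eq_openI[OF J assms 1]) (auto intro: DERIV_cmult smooth_on_DERIV[OF h' assms])
  with 1[OF assms] show ?thesis
    by (simp add: generator_def v0_def xfield_def yfield_def yscale_def)
qed

lemma group_invariant_rz: "group_invariant Q \<Omega> (rz k0 g h)"
  unfolding group_invariant_def
proof (intro allI impI)
  fix \<gamma> :: "real \<Rightarrow> R4" and a b :: real
  let ?I = "{a<..<b}"
  assume ic: "integral_curve Q ?I \<gamma>"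
    and mem: "\<forall>s\<in>?I. (\<lambda>(t, x, y, v). (t, x, y)) (\<gamma> s) \<in> \<Omega>"
  define T X Y where "T = (\<lambda>s. fst (\<gamma> s))" and "X = (\<lambda>s. fst (snd (\<gamma> s)))"
    and "Y = (\<lambda>s. fst (snd (snd (\<gamma> s))))"
  have base: "(\<lambda>(t, x, y, v). (t, x, y)) (\<gamma> s) = (T s, X s, Y s)" for s
    by (simp add: T_def X_def Y_def case_prod_beta)
  have \<Omega>: "(T s, X s, Y s) \<in> \<Omega>" if "s \<in> ?I" for s
    using mem that base by metis
  have Q: "Q (\<gamma> s) = (0, 2 * k0 * X s + g (T s) + Y s * deriv h (T s), yscale (T s) (Y s),
      2 * k0 * snd (snd (snd (\<gamma> s))) - deriv g (T s) - Y s * deriv (deriv h) (T s))"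
    if "s \<in> ?I" for s
    using generator_eq[OF \<Omega>D(1)[OF \<Omega>[OF that]], of "X s" "Y s" "snd (snd (snd (\<gamma> s)))"]
    by (simp add: T_def X_def Y_def)
  note der = integral_curve_components[OF ic _ Q, folded T_def X_def Y_def]
  \<comment> \<open>Constancy of t comes before that of z: it makes g, h and h' constants along the
    curve, so that z varies through \<open>X\<close> and \<open>Y\<close> only.\<close>
  have "T constant_on ?I"
    by (rule has_field_derivative_0_imp_constant_on) (use der(1) in auto)
  then obtain t where T: "T s = t" if "s \<in> ?I" for s
    unfolding constant_on_def by metis
  have "(\<lambda>s. zvar k0 g h (t, X s, Y s)) constant_on ?I"
  proof (rule has_field_derivative_0_imp_constant_on)
    fix s assume s: "s \<in> ?I"
    have "yscale t (Y s) \<noteq> 0" using \<Omega>D(2) \<Omega>[OF s] T[OF s] by metis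
    \<comment> \<open>The left side is the derivative of \<open>x + xshift\<close> along the curve.
      Its rate 2 k0 is also that of s^2, so the quotient z is stationary.\<close>
    moreover have "2 * k0 * X s + g t + Y s * deriv h t + deriv h t / k0 * yscale t (Y s)
        = 2 * k0 * (X s + xshift t (Y s))"
      using k0 by (simp add: xshift_def yscale_def power2_eq_square field_simps)
    ultimately show "((\<lambda>s. zvar k0 g h (t, X s, Y s)) has_field_derivative 0) (at s)"
      unfolding zvar_eq using der(2,3)[OF s s] T[OF s]
      by (auto intro!: derivative_eq_intros simp: power2_eq_square)
  qed auto
  then obtain z where "zvar k0 g h (t, X s, Y s) = z" if "s \<in> ?I" for s
    unfolding constant_on_def by metis
  then show "(\<lambda>s. rz k0 g h ((\<lambda>(t, x, y, v). (t, x, y)) (\<gamma> s))) constant_on ?I"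
    unfolding base constant_on_def by (intro exI[of _ "(t, z)"]) (auto simp: rz_eq T)
qed

text \<open>On a curve inside the graph the last component is \<open>u\<close> of the base point.
  Its derivative at 0 comes once from the chain rule and once from the generator; equating the two
  gives the invariant surface condition.\<close>

lemma invariant_on_imp_infinitesimal:
  assumes inv: "invariant_on Q \<Omega> u" and p: "(t, x, y) \<in> \<Omega>"
    and u: "(u has_derivative u') (at (t, x, y))"
  shows "u' (0, 2 * k0 * x + g t + y * deriv h t, yscale t y) =
    2 * k0 * u (t, x, y) - deriv g t - y * deriv (deriv h) t"
proof -
  let ?v = "u (t, x, y)"
  have "(t, x, y, ?v) \<in> graph_on \<Omega> u" using p by (simp add: graph_on_def)
  then obtain \<delta> \<gamma> where \<delta>: "\<delta> > 0" and ic: "integral_curve Q {-\<delta><..<\<delta>} \<gamma>"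
    and \<gamma>0: "\<gamma> 0 = (t, x, y, ?v)" and sub: "\<gamma> ` {-\<delta><..<\<delta>} \<subseteq> graph_on \<Omega> u"
    using inv unfolding invariant_on_def locally_invariant_def by metis
  define B where "B = (\<lambda>s. (fst (\<gamma> s), fst (snd (\<gamma> s)), fst (snd (snd (\<gamma> s)))))"
  have Q: "Q (\<gamma> 0) = (0, 2 * k0 * x + g t + y * deriv h t, yscale t y,
      2 * k0 * ?v - deriv g t - y * deriv (deriv h) t)"
    unfolding \<gamma>0 by (rule generator_eq[OF \<Omega>D(1)[OF p]])
  have 0: "0 \<in> {-\<delta><..<\<delta>}" using \<delta> by simp
  note der = integral_curve_components[OF ic 0 Q, unfolded has_real_derivative_iff_has_vector_derivative]
  have "(B has_vector_derivative (0, 2 * k0 * x + g t + y * deriv h t, yscale t y)) (at 0)"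
    unfolding B_def by (intro has_vector_derivative_Pair' der)
  moreover have "(u has_derivative u') (at (B 0))"
    using u by (simp add: B_def \<gamma>0)
  ultimately have "((u \<circ> B) has_vector_derivative
      u' (0, 2 * k0 * x + g t + y * deriv h t, yscale t y)) (at 0)"
    using vector_derivative_diff_chain_within[of B _ 0 UNIV u u'] has_derivative_at_withinI by blast
  moreover have "((u \<circ> B) has_vector_derivative
      2 * k0 * ?v - deriv g t - y * deriv (deriv h) t) (at 0)"
    by (rule has_vector_derivative_transform_within_open[OF der(4) open_greaterThanLessThan 0])
       (use sub in \<open>force simp: graph_on_def B_def\<close>)
  ultimately show ?thesis by (rule vector_derivative_unique_at)
qed

section \<open>Invariant functions are those given by the reduction formula\<close>

text \<open>The reduction formula solved for \<open>w\<close>. It makes sense for every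
  \<open>u\<close>, so its constancy on fibres can be proved before any \<open>w\<close>
  exists.\<close>

definition profile :: "(real \<times> real \<times> real \<Rightarrow> real) \<Rightarrow> real \<times> real \<times> real \<Rightarrow> real" where
  "profile u = (\<lambda>(t, x, y). (u (t, x, y) - ushift t y) / (yscale t y)\<^sup>2)"

lemma ansatz_iff_profile:
  "p \<in> \<Omega> \<Longrightarrow> u p = ansatz k0 g h w p \<longleftrightarrow> profile u p = w (rz k0 g h p)"
  using \<Omega>D by (cases p) (auto simp: ansatz_eq profile_def rz_eq field_simps)

lemma profile_constant:
  assumes u: "smooth_on \<Omega> u" and inv: "invariant_on Q \<Omega> u"
    and p: "p \<in> \<Omega>" "p' \<in> \<Omega>" "rz k0 g h p = rz k0 g h p'"
  shows "profile u p = profile u p'"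
proof -
  obtain t z where q: "rz k0 g h p = (t, z)" by fastforce
  define Y where "Y = {y. fibre y (t, z) \<in> \<Omega>}"
  have Y: "Y = (\<lambda>(t, x, y). y) ` {p \<in> \<Omega>. rz k0 g h p = (t, z)}"
  proof (intro equalityI subsetI)
    fix y assume "y \<in> Y"
    then show "y \<in> (\<lambda>(t, x, y). y) ` {p \<in> \<Omega>. rz k0 g h p = (t, z)}"
      by (intro image_eqI[of _ _ "fibre y (t, z)"]) (auto simp: Y_def rz_fibre, simp add: fibre_def)
  next
    fix y assume "y \<in> (\<lambda>(t, x, y). y) ` {p \<in> \<Omega>. rz k0 g h p = (t, z)}"
    then obtain s x where "(s, x, y) \<in> \<Omega>" "rz k0 g h (s, x, y) = (t, z)" by auto
    then show "y \<in> Y" using fibre_rz by (metis Y_def mem_Collect_eq)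
  qed
  have "connected Y"
    unfolding Y using region
    by (intro connected_continuous_image)
       (auto simp: reduction_region_def case_prod_beta intro!: continuous_intros)
  moreover have "open Y"
  proof -
    have "continuous_on UNIV (\<lambda>y. fibre y (t, z))"
      unfolding fibre_def yscale_def xshift_def prod.case using k0 by (intro continuous_intros) auto
    then have "open ((\<lambda>y. fibre y (t, z)) -` \<Omega>)" using open_\<Omega> by (simp add: open_vimage)
    then show ?thesis by (simp add: Y_def vimage_def)
  qed
  moreover have "((\<lambda>y. profile u (fibre y (t, z))) has_real_derivative 0) (at y)" if "y \<in> Y" for y
  proof -
    define x where "x = (yscale t y)\<^sup>2 * z - xshift t y"
    have pt: "(t, x, y) \<in> \<Omega>" using that by (simp add: Y_def fibre_def x_def)
    then have s: "yscale t y \<noteq> 0" by (rule \<Omega>D)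
    note u' = smooth_onD[OF u pt]
    let ?c = "2 * k0 * x + g t + y * deriv h t"
    define U where "U = (\<lambda>y. u (fibre y (t, z)))"
    \<comment> \<open>The left side is the velocity of x along the fibre. It equals
      \<open>?c / yscale t y\<close>, so the fibre parametrised by y is an orbit of the base flow
      with its velocity divided by s, the y-component of the generator.\<close>
    have c: "2 * yscale t y * k0 * z - deriv h t / k0 = ?c / yscale t y"
    proof -
      have "?c = yscale t y * (2 * yscale t y * k0 * z - deriv h t / k0)"
        using k0 by (simp add: x_def xshift_def yscale_def power2_eq_square field_simps)
      then show ?thesis using s by simp
    qed
    have X: "((\<lambda>y. (yscale t y)\<^sup>2 * z - xshift t y) has_real_derivative ?c / yscale t y) (at y)"
      unfolding c[symmetric] by (auto intro!: derivative_eq_intros)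
    have "((\<lambda>y. fibre y (t, z)) has_vector_derivative (0, ?c / yscale t y, 1)) (at y)"
      unfolding fibre_def prod.case using X
      by (intro has_vector_derivative_Pair')
         (auto simp: has_real_derivative_iff_has_vector_derivative)
    moreover have "fibre y (t, z) = (t, x, y)" by (simp add: fibre_def x_def)
    moreover have "(0, ?c / yscale t y, 1) = (1 / yscale t y) *\<^sub>R (0, ?c, yscale t y)"
      using s by simp
    ultimately have "((u \<circ> (\<lambda>y. fibre y (t, z))) has_vector_derivative
        frechet_derivative u (at (t, x, y)) ((1 / yscale t y) *\<^sub>R (0, ?c, yscale t y))) (at y)"
      using vector_derivative_diff_chain_within[of "\<lambda>y. fibre y (t, z)" _ y UNIV u
          "frechet_derivative u (at (t, x, y))"] has_derivative_at_withinI[OF u'] by metis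
    also have "frechet_derivative u (at (t, x, y)) ((1 / yscale t y) *\<^sub>R (0, ?c, yscale t y)) =
        (1 / yscale t y) * (2 * k0 * u (t, x, y) - deriv g t - y * deriv (deriv h) t)"
      using invariant_on_imp_infinitesimal[OF inv pt u'] linear_scale[OF has_derivative_linear[OF u']]
      by (metis real_scaleR_def)
    finally have U: "(U has_real_derivative
        (1 / yscale t y) * (2 * k0 * u (t, x, y) - deriv g t - y * deriv (deriv h) t)) (at y)"
      by (simp add: has_real_derivative_iff_has_vector_derivative o_def U_def)
    \<comment> \<open>As the y-derivative of A is h'' / k0, this says that U - A changes at the
      relative rate 2 k0 / s, exactly as s^2 does.\<close>
    have "(1 / yscale t y) * (2 * k0 * u (t, x, y) - deriv g t - y * deriv (deriv h) t)
        - deriv (deriv h) t / k0 = 2 * k0 * (u (t, x, y) - ushift t y) / yscale t y"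
    proof -
      have "2 * k0 * u (t, x, y) - deriv g t - y * deriv (deriv h) t
          - yscale t y * deriv (deriv h) t / k0 = 2 * k0 * (u (t, x, y) - ushift t y)"
        using k0 by (simp add: ushift_def yscale_def power2_eq_square field_simps)
      from this[symmetric] show ?thesis using s by (simp add: diff_divide_distrib)
    qed
    moreover have "U y = u (t, x, y)" by (simp add: U_def fibre_def x_def)
    ultimately have "((\<lambda>y. (U y - ushift t y) / (yscale t y)\<^sup>2) has_real_derivative 0) (at y)"
      using s by (auto intro!: derivative_eq_intros U simp: power2_eq_square)
    then show ?thesis by (simp add: profile_def U_def fibre_def)
  qed
  ultimately have "(\<lambda>y. profile u (fibre y (t, z))) constant_on Y"
    by (intro has_field_derivative_0_imp_constant_on)
  moreover have "\<exists>y\<in>Y. profile u r = profile u (fibre y (t, z))"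
    if "r \<in> \<Omega>" "rz k0 g h r = (t, z)" for r
  proof -
    obtain t' x y where r: "r = (t', x, y)" by (cases r)
    then have "fibre y (t, z) = r" using that fibre_rz by metis
    then show ?thesis using that by (auto simp: Y_def intro!: bexI[of _ y])
  qed
  ultimately show ?thesis
    using p q unfolding constant_on_def by metis
qed

text \<open>The integral curve can be written down: z and the value \<open>w (t, z)\<close> are
  frozen and only s moves.\<close>

lemma invariant_on_ansatz:
  assumes u: "\<And>p. p \<in> \<Omega> \<Longrightarrow> u p = ansatz k0 g h w p"
  shows "invariant_on Q \<Omega> u"
  unfolding invariant_on_def locally_invariant_def
proof
  fix P assume "P \<in> graph_on \<Omega> u"
  then obtain t x y where P: "P = (t, x, y, u (t, x, y))" and p: "(t, x, y) \<in> \<Omega>"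
    by (auto simp: graph_on_def)
  note t = \<Omega>D(1)[OF p]
  define z where "z = zvar k0 g h (t, x, y)"
  \<comment> \<open>Obtained by solving s = s(0) exp(k0 \<epsilon>) for y, where s(0) is the value
    of s at the starting point.\<close>
  define Y where "Y = (\<lambda>\<epsilon>. (yscale t y * exp (k0 * \<epsilon>) - 2 * h t) / k0)"
  define \<gamma> where "\<gamma> = (\<lambda>\<epsilon>. (t, (yscale t (Y \<epsilon>))\<^sup>2 * z - xshift t (Y \<epsilon>), Y \<epsilon>,
    (yscale t (Y \<epsilon>))\<^sup>2 * w (t, z) + ushift t (Y \<epsilon>)))"
  have Y0: "Y 0 = y" using k0 by (simp add: Y_def yscale_def)
  have Y: "(Y has_real_derivative yscale t (Y \<epsilon>)) (at \<epsilon>)" for \<epsilon>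
    unfolding Y_def yscale_def using k0 by (auto intro!: derivative_eq_intros simp: field_simps)
  have "(\<gamma> has_vector_derivative Q (\<gamma> \<epsilon>)) (at \<epsilon>)" for \<epsilon>
    unfolding \<gamma>_def generator_eq[OF t]
  proof (intro has_vector_derivative_Pair',
      unfold has_real_derivative_iff_has_vector_derivative[symmetric])
    show "((\<lambda>\<epsilon>. (yscale t (Y \<epsilon>))\<^sup>2 * z - xshift t (Y \<epsilon>)) has_real_derivative
        2 * k0 * ((yscale t (Y \<epsilon>))\<^sup>2 * z - xshift t (Y \<epsilon>)) + g t + Y \<epsilon> * deriv h t) (at \<epsilon>)"
      using k0 by (auto intro!: derivative_eq_intros Y
          simp: xshift_def yscale_def power2_eq_square field_simps)
    show "((\<lambda>\<epsilon>. (yscale t (Y \<epsilon>))\<^sup>2 * w (t, z) + ushift t (Y \<epsilon>)) has_real_derivative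
        2 * k0 * ((yscale t (Y \<epsilon>))\<^sup>2 * w (t, z) + ushift t (Y \<epsilon>)) - deriv g t
          - Y \<epsilon> * deriv (deriv h) t) (at \<epsilon>)"
      using k0 by (auto intro!: derivative_eq_intros Y
          simp: ushift_def yscale_def power2_eq_square field_simps)
  qed (auto intro: Y)
  then have ic: "integral_curve Q I \<gamma>" for I by (simp add: integral_curve_def)
  \<comment> \<open>The curve solves the flow equation for every parameter; only the need to stay
    over \<open>\<Omega>\<close> confines it to a short interval.\<close>
  have \<gamma>: "\<gamma> \<epsilon> \<in> graph_on \<Omega> u" if "fibre (Y \<epsilon>) (t, z) \<in> \<Omega>" for \<epsilon>
    using that u[OF that] rz_fibre[OF that]
    by (auto simp: graph_on_def \<gamma>_def fibre_def ansatz_eq rz_eq)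
  have "fibre (Y 0) (t, z) = (t, x, y)"
    using fibre_rz[OF p] by (simp add: Y0 z_def rz_eq)
  moreover have "continuous_on UNIV (\<lambda>\<epsilon>. fibre (Y \<epsilon>) (t, z))"
    unfolding fibre_def yscale_def xshift_def Y_def prod.case using k0
    by (intro continuous_intros) auto
  then have "open ((\<lambda>\<epsilon>. fibre (Y \<epsilon>) (t, z)) -` \<Omega>)" using open_\<Omega> by (simp add: open_vimage)
  ultimately obtain \<delta> where \<delta>: "\<delta> > 0" "ball 0 \<delta> \<subseteq> (\<lambda>\<epsilon>. fibre (Y \<epsilon>) (t, z)) -` \<Omega>"
    using p by (metis open_contains_ball vimageI)
  then have "\<gamma> ` {-\<delta><..<\<delta>} \<subseteq> graph_on \<Omega> u"
    using \<gamma> by (auto simp: ball_eq_greaterThanLessThan)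
  moreover have "\<gamma> 0 = P"
    using \<open>fibre (Y 0) (t, z) = (t, x, y)\<close> u[OF p]
    by (simp add: \<gamma>_def P fibre_def Y0 ansatz_eq z_def)
  ultimately show "\<exists>\<delta>>0. \<exists>\<gamma>. integral_curve Q {-\<delta><..<\<delta>} \<gamma> \<and> \<gamma> 0 = P \<and>
      \<gamma> ` {-\<delta><..<\<delta>} \<subseteq> graph_on \<Omega> u"
    using \<delta>(1) ic by blast
qed

text \<open>This is the local expression of \<open>w\<close>: at fixed height y, s and A are smooth
  functions of t alone, s does not vanish, and \<open>u\<close> is composed with a smooth
  section.\<close>

lemma Ck_on_profile_fibre:
  assumes u: "smooth_on \<Omega> u"
  shows "Ck_on n (fibre_dom y) (\<lambda>q. profile u (fibre y q))"
proof -
  have sub: "fibre_dom y \<subseteq> J \<times> UNIV" by (auto simp: fibre_dom_eq)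
  have [simp]: "yscale (fst q) y \<noteq> 0" if "q \<in> fibre_dom y" for q
    using that \<Omega>D(2) by (auto simp: fibre_dom_def fibre_def split: prod.splits)
  have "Ck_on n (fibre_dom y) (\<lambda>q. u (fibre y q))"
    by (rule Ck_on_compose[OF open_fibre_dom open_\<Omega>])
       (use u Ck_on_subset[OF Ck_on_fibre sub] in \<open>auto simp: fibre_dom_def smooth_on_def\<close>)
  then have "Ck_on n (fibre_dom y) (\<lambda>q. (u (fibre y q) + (-1) * ushift (fst q) y)
      * inverse (yscale (fst q) y * yscale (fst q) y))"
    by (intro Ck_on_add Ck_on_mult Ck_on_inverse Ck_on_const open_fibre_dom
        Ck_on_subset[OF Ck_on_coeffs(1) sub] Ck_on_subset[OF Ck_on_coeffs(3) sub]) auto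
  moreover have "profile u (fibre y q) = (u (fibre y q) + (-1) * ushift (fst q) y)
      * inverse (yscale (fst q) y * yscale (fst q) y)" for q
    by (simp add: profile_def fibre_def case_prod_beta power2_eq_square divide_inverse)
  ultimately show ?thesis by simp
qed

lemma invariant_on_iff:
  assumes u: "smooth_on \<Omega> u"
  shows "invariant_on Q \<Omega> u \<longleftrightarrow>
    (\<exists>w. smooth_on (rz k0 g h ` \<Omega>) w \<and> (\<forall>p\<in>\<Omega>. u p = ansatz k0 g h w p))"
proof
  assume inv: "invariant_on Q \<Omega> u"
  \<comment> \<open>Any point of the fibre serves, by \<open>profile_constant\<close>. The choice
    need not vary smoothly, so smoothness of \<open>w\<close> is taken from the sections
    instead.\<close>
  define w where "w = (\<lambda>q. profile u (SOME p. p \<in> \<Omega> \<and> rz k0 g h p = q))"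
  have w: "profile u p = w (rz k0 g h p)" if "p \<in> \<Omega>" for p
  proof -
    have "(SOME p'. p' \<in> \<Omega> \<and> rz k0 g h p' = rz k0 g h p) \<in> \<Omega> \<and>
        rz k0 g h (SOME p'. p' \<in> \<Omega> \<and> rz k0 g h p' = rz k0 g h p) = rz k0 g h p"
      by (rule someI[of _ p]) (use that in auto)
    then show ?thesis
      unfolding w_def using profile_constant[OF u inv that] by metis
  qed
  have "smooth_on (rz k0 g h ` \<Omega>) w"
    unfolding smooth_on_def
  proof (intro allI Ck_on_local)
    fix n q assume "q \<in> rz k0 g h ` \<Omega>"
    then obtain y where y: "q \<in> fibre_dom y" by (auto simp: rz_image)
    have "profile u (fibre y q) = w q" if "q \<in> fibre_dom y" for q
      using w[of "fibre y q"] that rz_fibre by (simp add: fibre_dom_def)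
    from Ck_on_cong[OF open_fibre_dom this Ck_on_profile_fibre[OF u]] y
    show "\<exists>U. open U \<and> q \<in> U \<and> Ck_on n U w" using open_fibre_dom by blast
  qed
  with w show "\<exists>w. smooth_on (rz k0 g h ` \<Omega>) w \<and> (\<forall>p\<in>\<Omega>. u p = ansatz k0 g h w p)"
    using ansatz_iff_profile by blast
next
  show "\<exists>w. smooth_on (rz k0 g h ` \<Omega>) w \<and> (\<forall>p\<in>\<Omega>. u p = ansatz k0 g h w p) \<Longrightarrow>
      invariant_on Q \<Omega> u"
    using invariant_on_ansatz by blast
qed

text \<open>The same \<open>w\<close> serves on both sides: \<open>reduced_zk\<close> is evaluated
  on the image of \<open>\<Omega>\<close>, so vanishing there and vanishing of \<open>zk u\<close>
  on \<open>\<Omega>\<close> are one condition.\<close>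

lemma invariant_solution_iff:
  assumes u: "smooth_on \<Omega> u"
  shows "invariant_on Q \<Omega> u \<and> (\<forall>p\<in>\<Omega>. zk u p = 0) \<longleftrightarrow>
    (\<exists>w. smooth_on (rz k0 g h ` \<Omega>) w \<and> (\<forall>q\<in>rz k0 g h ` \<Omega>. reduced_zk k0 w q = 0) \<and>
      (\<forall>p\<in>\<Omega>. u p = ansatz k0 g h w p))"
proof -
  have "(\<forall>p\<in>\<Omega>. zk u p = 0) \<longleftrightarrow> (\<forall>q\<in>rz k0 g h ` \<Omega>. reduced_zk k0 w q = 0)"
    if w: "smooth_on (rz k0 g h ` \<Omega>) w" and eq: "\<forall>p\<in>\<Omega>. u p = ansatz k0 g h w p" for w
    using zk_cong[OF open_\<Omega>, of u "ansatz k0 g h w"] zk_ansatz[OF w] eq by auto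
  then show ?thesis
    unfolding invariant_on_iff[OF u] by blast
qed

section \<open>Normalisation of k0 to 1\<close>

lemma deriv_scaled:
  assumes "t \<in> J"
  shows "deriv (\<lambda>t. g t / k0) t = deriv g t / k0"
    and "deriv (\<lambda>t. h t / k0) t = deriv h t / k0"
    and "deriv (deriv (\<lambda>t. h t / k0)) t = deriv (deriv h) t / k0"
proof -
  have *: "deriv (\<lambda>t. f t / k0) s = deriv f s / k0" if "smooth_on J f" "s \<in> J" for f s
    using DERIV_imp_deriv[OF DERIV_cdivide[OF smooth_on_DERIV[OF that]]] .
  show "deriv (\<lambda>t. g t / k0) t = deriv g t / k0" "deriv (\<lambda>t. h t / k0) t = deriv h t / k0"
    using * g h assms by auto
  show "deriv (deriv (\<lambda>t. h t / k0)) t = deriv (deriv h) t / k0"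
    by (rule deriv_eq_openI[OF J assms *[OF h]])
       (auto intro: DERIV_cdivide smooth_on_DERIV[OF h' assms])
qed

text \<open>Over \<open>J\<close> the generator is linear in k0, g and h together, so k0 can be
  factored out of all three.\<close>

lemma generator_scaled:
  assumes "t \<in> J"
  shows "Q (t, x, y, v) =
    k0 *\<^sub>R generator 1 (\<lambda>t. g t / k0) (\<lambda>t. 2 * (h t / k0)) (t, x, y, v)"
proof -
  have 1: "deriv (\<lambda>t. 2 * (h t / k0)) s = 2 * (deriv h s / k0)" if "s \<in> J" for s
    using DERIV_imp_deriv[OF DERIV_cmult[OF DERIV_cdivide[OF smooth_on_DERIV[OF h that]]]] .
  have 2: "deriv (deriv (\<lambda>t. 2 * (h t / k0))) t = 2 * (deriv (deriv h) t / k0)"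
    by (rule deriv_eq_openI[OF J assms 1])
       (auto intro!: DERIV_cmult DERIV_cdivide smooth_on_DERIV[OF h' assms])
  show ?thesis
    unfolding generator_eq[OF assms]
    unfolding generator_def v0_def xfield_def yfield_def prod.case
      1[OF assms] 2 deriv_scaled(1)[OF assms]
    using k0 by (simp add: yscale_def algebra_simps)
qed

text \<open>Rescaling divides s by k0 and leaves \<open>x + xshift\<close> unchanged; the
  denominator of z alone produces the factor.\<close>

lemma zvar_scaled:
  assumes "p \<in> \<Omega>"
  shows "zvar 1 (\<lambda>t. g t / k0) (\<lambda>t. h t / k0) p = k0\<^sup>2 * zvar k0 g h p"
proof -
  obtain t x y where p: "p = (t, x, y)" by (cases p)
  have "yscale t y \<noteq> 0" and t: "t \<in> J" using \<Omega>D assms p by auto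
  moreover have "2 * (h t / k0) + y = yscale t y / k0"
    using k0 by (simp add: yscale_def field_simps)
  moreover have "x + (g t / k0 + 2 * (h t / k0 + y) * (deriv h t / k0)) / 2 = x + xshift t y"
    using k0 by (simp add: xshift_def power2_eq_square field_simps)
  ultimately show ?thesis
    unfolding p zvar_eq
    by (simp add: zvar_def deriv_scaled[OF t] power_divide)
qed

text \<open>The factor k0^2 on \<open>w\<close> makes up for the division of s^2 by k0^2, the
  argument z / k0^2 undoes the scaling of z, and A is unchanged.\<close>

lemma ansatz_scaled:
  assumes "p \<in> \<Omega>"
  shows "ansatz 1 (\<lambda>t. g t / k0) (\<lambda>t. h t / k0) (\<lambda>(r, z). k0\<^sup>2 * w (r, z / k0\<^sup>2)) p =
    ansatz k0 g h w p"
proof -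
  obtain t x y where p: "p = (t, x, y)" by (cases p)
  have t: "t \<in> J" using \<Omega>D assms p by auto
  moreover have "2 * (h t / k0) + y = yscale t y / k0"
    using k0 by (simp add: yscale_def field_simps)
  moreover have "(deriv g t / k0 + 2 * (h t / k0 + y) * (deriv (deriv h) t / k0)) / 2 = ushift t y"
    using k0 by (simp add: ushift_def power2_eq_square field_simps)
  ultimately show ?thesis
    unfolding p ansatz_eq using zvar_scaled[OF assms] k0
    by (simp add: ansatz_def p deriv_scaled[OF t] power_divide)
qed

end

lemma
  fixes c :: real
  assumes "open R" "smooth_on R w" "c \<noteq> 0" "(r, z) \<in> R"
  shows Wz_scaled: "Wz (\<lambda>(r, z). a * w (r, z / c)) (r, c * z) = a * Wz w (r, z) / c"
    and Wt_scaled: "Wt (\<lambda>(r, z). a * w (r, z / c)) (r, c * z) = a * Wt w (r, z)"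
proof -
  have "((\<lambda>s. s / c) has_real_derivative 1 / c) (at (c * z))"
    using assms(3) by (auto intro!: derivative_eq_intros)
  from smooth_on_chain[OF assms(2) _ DERIV_const this, of r]
  have "((\<lambda>s. w (r, s / c)) has_real_derivative Wz w (r, z) / c) (at (c * z))"
    using assms(3,4) by simp
  from DERIV_imp_deriv[OF DERIV_cmult[OF this, of a]]
  show "Wz (\<lambda>(r, z). a * w (r, z / c)) (r, c * z) = a * Wz w (r, z) / c"
    by (simp add: Wz_def)
  have "((\<lambda>s. w (s, c * z / c)) has_real_derivative Wt w (r, z)) (at r)"
    using smooth_on_chain[OF assms(2) _ DERIV_ident DERIV_const, of r z] assms(3,4) by simp
  from DERIV_imp_deriv[OF DERIV_cmult[OF this, of a]]
  show "Wt (\<lambda>(r, z). a * w (r, z / c)) (r, c * z) = a * Wt w (r, z)"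
    by (simp add: Wt_def)
qed

lemma
  assumes "open R" "q \<in> R" "\<And>q. q \<in> R \<Longrightarrow> w q = w' q"
  shows Wt_cong: "Wt w q = Wt w' q" and Wz_cong: "Wz w q = Wz w' q"
proof -
  obtain t z where q: "q = (t, z)" by (cases q)
  have ev: "eventually (\<lambda>s. w (f s) = w' (f s)) (nhds r)"
    if "continuous_on UNIV f" "f r \<in> R" for f :: "real \<Rightarrow> _" and r
    unfolding eventually_nhds using assms that
    by (intro exI[of _ "f -` R"]) (auto simp: open_vimage)
  show "Wt w q = Wt w' q" "Wz w q = Wz w' q"
    using assms(2) ev[of "\<lambda>s. (s, z)" t] ev[of "\<lambda>s. (t, s)" z]
    by (simp_all add: q Wt_def Wz_def deriv_cong_ev continuous_on_Pair)
qed

text \<open>Scaling z and \<open>w\<close> by the same k^2 preserves w_z and w_zt and divides w_zz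
  by k^2, which the factor w + 4 z^2 absorbs.\<close>

lemma reduced_zk_scaled:
  assumes R: "open R" and w: "smooth_on R w" and k: "k \<noteq> 0" and q: "(r, z) \<in> R"
  shows "reduced_zk 1 (\<lambda>(r, z). k\<^sup>2 * w (r, z / k\<^sup>2)) (r, k\<^sup>2 * z) = reduced_zk k w (r, z)"
proof -
  let ?w = "\<lambda>(r, z). k\<^sup>2 * w (r, z / k\<^sup>2)"
  let ?R = "(\<lambda>(r, z). (r, z / k\<^sup>2)) -` R"
  have c: "k\<^sup>2 \<noteq> 0" using k by simp
  have R': "open ?R"
    using R c by (intro open_vimage) (auto simp: case_prod_beta intro!: continuous_intros)
  have q': "(r, k\<^sup>2 * z) \<in> ?R" using q k by simp
  \<comment> \<open>The factor 1 brings the first derivative into the shape of the scaling rules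
    with \<open>a = 1\<close>, ready for a second differentiation.\<close>
  have Wz: "Wz ?w p = (\<lambda>(r, z). 1 * Wz w (r, z / k\<^sup>2)) p" if "p \<in> ?R" for p
    using that Wz_scaled[OF R w c, of "fst p" "snd p / k\<^sup>2" "k\<^sup>2"] k by (cases p) simp
  have W2: "Wt (Wz ?w) (r, k\<^sup>2 * z) = Wt (\<lambda>(r, z). 1 * Wz w (r, z / k\<^sup>2)) (r, k\<^sup>2 * z)"
    "Wz (Wz ?w) (r, k\<^sup>2 * z) = Wz (\<lambda>(r, z). 1 * Wz w (r, z / k\<^sup>2)) (r, k\<^sup>2 * z)"
    by (rule Wt_cong[OF R' q' Wz] Wz_cong[OF R' q' Wz], assumption)+
  note wz = smooth_on_Wz[OF R w]
  show ?thesis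
    unfolding reduced_zk_def prod.case W2 Wz[OF q'] Wt_scaled[OF R wz c q] Wz_scaled[OF R wz c q]
    using k by (simp add: field_simps)
qed

theorem mainTheorem6:
  fixes k0 :: real and g h :: "real \<Rightarrow> real" and J :: "real set"
    and \<Omega> :: "(real \<times> real \<times> real) set"
  assumes "k0 \<noteq> 0"
    and "open J" "is_interval J"
    and "smooth_on J g" "smooth_on J h"
    and "\<exists>t\<in>J. h t \<noteq> 0"
    and "reduction_region k0 g h J \<Omega>"
  shows "let Q = generator k0 g (\<lambda>t. 2 * h t);
             R = rz k0 g h ` \<Omega>;
             g1 = (\<lambda>t. g t / k0);
             h1 = (\<lambda>t. h t / k0)
         in
    \<comment> \<open>\<open>r\<close> and \<open>z\<close> are invariants\<close>
    group_invariant Q \<Omega> (rz k0 g h) \<and>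
    \<comment> \<open>the reduction formula describes exactly the invariant functions\<close>
    (\<forall>u. smooth_on \<Omega> u \<longrightarrow>
       (invariant_on Q \<Omega> u \<longleftrightarrow>
          (\<exists>w. smooth_on R w \<and> (\<forall>p\<in>\<Omega>. u p = ansatz k0 g h w p)))) \<and>
    \<comment> \<open>the reduced equation is the result of substituting the formula in the ZK equation\<close>
    (\<forall>w. smooth_on R w \<longrightarrow>
       (\<forall>p\<in>\<Omega>. zk (ansatz k0 g h w) p = reduced_zk k0 w (rz k0 g h p))) \<and>
    \<comment> \<open>invariant solutions correspond to solutions of the reduced equation\<close>
    (\<forall>u. smooth_on \<Omega> u \<longrightarrow>
       (invariant_on Q \<Omega> u \<and> (\<forall>p\<in>\<Omega>. zk u p = 0) \<longleftrightarrow>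
          (\<exists>w. smooth_on R w \<and> (\<forall>q\<in>R. reduced_zk k0 w q = 0) \<and>
               (\<forall>p\<in>\<Omega>. u p = ansatz k0 g h w p)))) \<and>
    \<comment> \<open>\<open>k\<^sub>0\<close> may be set to 1: the generator is \<open>k\<^sub>0\<close> times one with \<open>k\<^sub>0 = 1\<close>, so both generate
        the same subgroup, and the two reductions agree up to scaling \<open>z\<close> and \<open>w\<close>\<close>
    (\<forall>t\<in>J. \<forall>x y v. Q (t, x, y, v) = k0 *\<^sub>R generator 1 g1 (\<lambda>t. 2 * h1 t) (t, x, y, v)) \<and>
    (\<forall>p\<in>\<Omega>. zvar 1 g1 h1 p = k0\<^sup>2 * zvar k0 g h p) \<and>
    (\<forall>w. smooth_on R w \<longrightarrow>
       (let w1 = (\<lambda>(r, z). k0\<^sup>2 * w (r, z / k0\<^sup>2))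
        in (\<forall>p\<in>\<Omega>. ansatz 1 g1 h1 w1 p = ansatz k0 g h w p) \<and>
           (\<forall>(r, z)\<in>R. reduced_zk 1 w1 (r, k0\<^sup>2 * z) = reduced_zk k0 w (r, z))))"
proof -
  interpret zk_reduction k0 g h J \<Omega>
    using assms by unfold_locales
  show ?thesis
    unfolding Let_def
  proof (intro conjI allI ballI impI)
    show "group_invariant (generator k0 g (\<lambda>t. 2 * h t)) \<Omega> (rz k0 g h)"
      by (rule group_invariant_rz)
  next
    fix w q assume w: "smooth_on (rz k0 g h ` \<Omega>) w" and q: "q \<in> rz k0 g h ` \<Omega>"
    obtain r z where q_eq: "q = (r, z)" by (cases q)
    show "case q of (r, z) \<Rightarrow>
        reduced_zk 1 (\<lambda>(r, z). k0\<^sup>2 * w (r, z / k0\<^sup>2)) (r, k0\<^sup>2 * z) = reduced_zk k0 w (r, z)"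
      using reduced_zk_scaled[OF open_rz_image w k0] q q_eq by simp
  \<comment> \<open>The equivalence for solutions is settled before that for invariance, whose left
    side occurs inside it and would be rewritten first.\<close>
  qed (simp_all only: invariant_solution_iff, simp_all only: invariant_on_iff zk_ansatz
      generator_scaled zvar_scaled ansatz_scaled)
qed

end
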